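(* Let $n\ge 1$ and let $(\Gamma,X)$ be a graph with vertex set $X=\{1,\dots,n\}$. 1. The map which associates to every representation $u:X\to E$ of $\Gamma$ the pair $(\omega,c)\in\mathbb{R}^2$ of its parameters is surjective onto $\mathbb{R}^2$. Two reduced representations of $\Gamma$ are isomorphic if and only if they have the same parameters. 2. The degree of a reduced representation of $\Gamma$ with matrix $S(1,c)$ is the rank of this matrix, that is, $n-\mu(c)$, where $n=|X|$ and $\mu(c)$ is the multiplicity of $c$ as a root of the polynomial $\chi(x)=\det(S(1,x))$.
   Context: A graph $(\Gamma,X)$ is given by its vertex set $X=\{1,\dots,n\}$, $n\ge1$, and its set $\Gamma$ of edges, which are pairs $\{x,y\}$ of distinct points of $X$. For $i,j\in X$ put $\varepsilon_{i,j}=-1$ if $\{i,j\}\in\Gamma$ and $\varepsilon_{i,j}=1$ otherwise (in particular $\varepsilon_{i,i}=1$). A quadratic space $(E,\alpha)$ is a finite-dimensional real vector space $E$ with a symmetric bilinear form $\alpha$ (possibly degenerate or indefinite). A representation of $(\Gamma,X)$ with parameters $(\omega,c)\in\mathbb{R}^2$ is a map $u:X\to(E,\alpha)$, $i\mapsto u_i$, into a quadratic space such that $\alpha(u_i,u_i)=\omega$ for all $i$ and $\alpha(u_i,u_j)=\varepsilon_{i,j}\,c$ for all $i\ne j$. Its matrix is $S(u)=(\alpha(u_i,u_j))_{i,j\in X}$; since it depends only on $(\omega,c)$ it is also written $S(\omega,c)$: it is the $n\times n$ matrix with diagonal entries $\omega$ and off-diagonal $(i,j)$ entries $\varepsilon_{i,j}c$.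 The rank of $u$ is the rank of $S(u)$ and the degree of $u$ is $\dim E$. The representation $u$ is reduced if its degree equals its rank. Two representations $u:X\to(U,\alpha)$ and $v:X\to(V,\beta)$ of $(\Gamma,X)$ are isomorphic if there is an isometry (a linear bijection preserving the bilinear forms) $f$ of $(U,\alpha)$ onto $(V,\beta)$ with $f\circ u=v$. *)

theory Defs
  imports "HOL-Analysis.Analysis" "HOL-Computational_Algebra.Polynomial"
begin

text \<open>
  The vertex set of a graph is a finite type \<open>'n\<close>, with \<open>n = CARD('n)\<close>;
  types being nonempty, \<open>n \<ge> 1\<close> holds automatically.
\<close>

definition graph :: "'n set set \<Rightarrow> bool" where
  "graph \<Gamma> \<longleftrightarrow> (\<forall>e\<in>\<Gamma>. \<exists>x y. x \<noteq> y \<and> e = {x, y})"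

definition eps :: "'n set set \<Rightarrow> 'n \<Rightarrow> 'n \<Rightarrow> 'r::comm_ring_1" where
  "eps \<Gamma> i j = (if {i, j} \<in> \<Gamma> then - 1 else 1)"

text \<open>
  \<open>S_mat \<Gamma> \<omega> c\<close> is \<open>S(\<omega>,c)\<close>. The coefficient ring is arbitrary so that \<open>c\<close> may also be a
  polynomial indeterminate, as in \<open>chi_poly\<close>.
\<close>

definition S_mat :: "'n::finite set set \<Rightarrow> 'r \<Rightarrow> 'r \<Rightarrow> 'r::comm_ring_1 ^ 'n ^ 'n" where
  "S_mat \<Gamma> \<omega> c = (\<chi> i j. if i = j then \<omega> else eps \<Gamma> i j * c)"

definition chi_poly :: "'n::finite set set \<Rightarrow> real poly" where
  "chi_poly \<Gamma> = det (S_mat \<Gamma> 1 [:0, 1:])"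

text \<open>
  A quadratic space is a finite-dimensional subspace \<open>E\<close> of an arbitrary real vector space; the
  form is only constrained on \<open>E\<close>. Finite dimensionality must be required explicitly, since
  \<open>dim\<close> is \<open>0\<close> on infinite-dimensional spaces.
\<close>

definition quadratic_space :: "'a::real_vector set \<Rightarrow> ('a \<Rightarrow> 'a \<Rightarrow> real) \<Rightarrow> bool" where
  "quadratic_space E \<alpha> \<longleftrightarrow>
     subspace E \<and> (\<exists>B. finite B \<and> E = span B) \<and>
     (\<forall>x\<in>E. \<forall>y\<in>E. \<alpha> x y = \<alpha> y x) \<and>
     (\<forall>x\<in>E. \<forall>y\<in>E. \<forall>z\<in>E. \<alpha> (x + y) z = \<alpha> x z + \<alpha> y z) \<and>
     (\<forall>r. \<forall>x\<in>E. \<forall>y\<in>E. \<alpha> (r *\<^sub>R x) y = r * \<alpha> x y)"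

definition is_rep_with ::
  "'n set set \<Rightarrow> 'a::real_vector set \<Rightarrow> ('a \<Rightarrow> 'a \<Rightarrow> real) \<Rightarrow> ('n \<Rightarrow> 'a) \<Rightarrow> real \<times> real \<Rightarrow> bool"
where
  "is_rep_with \<Gamma> E \<alpha> u p \<longleftrightarrow>
     quadratic_space E \<alpha> \<and> (\<forall>i. u i \<in> E) \<and>
     (\<forall>i. \<alpha> (u i) (u i) = fst p) \<and>
     (\<forall>i j. i \<noteq> j \<longrightarrow> \<alpha> (u i) (u j) = eps \<Gamma> i j * snd p)"

definition is_rep ::
  "'n set set \<Rightarrow> 'a::real_vector set \<Rightarrow> ('a \<Rightarrow> 'a \<Rightarrow> real) \<Rightarrow> ('n \<Rightarrow> 'a) \<Rightarrow> bool" where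
  "is_rep \<Gamma> E \<alpha> u \<longleftrightarrow> (\<exists>p. is_rep_with \<Gamma> E \<alpha> u p)"

text \<open>
  If \<open>n \<ge> 2\<close> a representation has exactly one pair of parameters. If \<open>n = 1\<close> there is no condition
  on \<open>c\<close>, so \<open>(\<omega>, c)\<close> is a pair of parameters for every \<open>c\<close>. Hence having the
  same parameters is expressed by comparing the sets of all admissible pairs.
\<close>

definition params ::
  "'n set set \<Rightarrow> 'a::real_vector set \<Rightarrow> ('a \<Rightarrow> 'a \<Rightarrow> real) \<Rightarrow> ('n \<Rightarrow> 'a) \<Rightarrow> (real \<times> real) set" where
  "params \<Gamma> E \<alpha> u = {p. is_rep_with \<Gamma> E \<alpha> u p}"

definition rep_matrix :: "('a \<Rightarrow> 'a \<Rightarrow> real) \<Rightarrow> ('n::finite \<Rightarrow> 'a) \<Rightarrow> real ^ 'n ^ 'n" where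
  "rep_matrix \<alpha> u = (\<chi> i j. \<alpha> (u i) (u j))"

definition reduced_rep ::
  "'n::finite set set \<Rightarrow> 'a::real_vector set \<Rightarrow> ('a \<Rightarrow> 'a \<Rightarrow> real) \<Rightarrow> ('n \<Rightarrow> 'a) \<Rightarrow> bool" where
  "reduced_rep \<Gamma> E \<alpha> u \<longleftrightarrow> is_rep \<Gamma> E \<alpha> u \<and> dim E = rank (rep_matrix \<alpha> u)"

definition isometry_between ::
  "'a::real_vector set \<Rightarrow> ('a \<Rightarrow> 'a \<Rightarrow> real) \<Rightarrow> 'b::real_vector set \<Rightarrow> ('b \<Rightarrow> 'b \<Rightarrow> real) \<Rightarrow>
   ('a \<Rightarrow> 'b) \<Rightarrow> bool" where
  "isometry_between U \<alpha> V \<beta> f \<longleftrightarrow>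
     bij_betw f U V \<and>
     (\<forall>x\<in>U. \<forall>y\<in>U. f (x + y) = f x + f y) \<and>
     (\<forall>r. \<forall>x\<in>U. f (r *\<^sub>R x) = r *\<^sub>R f x) \<and>
     (\<forall>x\<in>U. \<forall>y\<in>U. \<beta> (f x) (f y) = \<alpha> x y)"

definition isomorphic_reps ::
  "'a::real_vector set \<Rightarrow> ('a \<Rightarrow> 'a \<Rightarrow> real) \<Rightarrow> ('n \<Rightarrow> 'a) \<Rightarrow>
   'b::real_vector set \<Rightarrow> ('b \<Rightarrow> 'b \<Rightarrow> real) \<Rightarrow> ('n \<Rightarrow> 'b) \<Rightarrow> bool" where
  "isomorphic_reps U \<alpha> u V \<beta> v \<longleftrightarrow> (\<exists>f. isometry_between U \<alpha> V \<beta> f \<and> f \<circ> u = v)"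

end

theory Submission
  imports Defs
begin

text \<open>
  A reduced representation is determined by its Gram matrix, for the following reason. Let
  \<open>u : X \<rightarrow> (U, \<alpha>)\<close> be reduced with Gram matrix \<open>S\<close>, and send
  \<open>x \<in> U\<close> to the vector \<open>L x = (\<alpha>(x, u\<^sub>i))\<^sub>i\<close>. Since
  \<open>L (\<Sum> a\<^sub>i u\<^sub>i) = S a\<close>, the image of \<open>L\<close> contains the column
  space of \<open>S\<close>, whose dimension is \<open>rank S = dim U\<close>. Hence \<open>L\<close> is a
  linear bijection of \<open>U\<close> onto the column space (\<open>gram_coordinates\<close>). In these
  coordinates \<open>u\<^sub>i\<close> is the \<open>i\<close>-th column of \<open>S\<close>, and the form is
  \<open>\<alpha>(x, y) = a \<bullet> L y\<close> for any \<open>a\<close> with \<open>L x = S a\<close>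
  (\<open>form_via_gram_coordinates\<close>). Nothing here depends on the representation except
  through \<open>S\<close>, so two reduced representations with the same Gram matrix are isomorphic
  (\<open>isomorphic_if_rep_matrix_eq\<close>). Conversely, isometries preserve Gram matrices. Every
  pair of parameters occurs, as \<open>S(\<omega>, c)\<close> is symmetric and is therefore the Gram matrix of
  the standard basis for the form that it defines on \<open>\<real>\<^sup>n\<close>.

  For the formula for the degree, write \<open>S(1, x) = I + x A\<close> with \<open>A\<close> symmetric. In
  terms of the eigenvalues \<open>\<lambda>\<^sub>i\<close> of \<open>A\<close> this means \<open>\<chi>(x) = \<Prod> (1 + x \<lambda>\<^sub>i)\<close>, and the factors vanishing at
  \<open>c\<close> have a simple root there and are as many as the dimension of the kernel of
  \<open>I + c A\<close>. The lemma \<open>order_det_pencil\<close> obtains this without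
  diagonalizing \<open>A\<close>: only a basis of the kernel of the single matrix \<open>I + c A\<close>,
  extended to a basis of \<open>\<real>\<^sup>n\<close>, is used.
\<close>

section \<open>The determinant of a symmetric pencil\<close>

lemma poly_det:
  fixes A :: "'a::comm_ring_1 poly ^ 'n ^ 'n"
  shows "poly (det A) x = det (\<chi> i j. poly (A $ i $ j) x)"
proof -
  have "poly (of_int k) x = of_int k" for k
    by (simp add: of_int_poly)
  then show ?thesis
    by (simp add: det_def poly_sum poly_prod)
qed

text \<open>
  Let \<open>M = I + c A\<close>, and let \<open>b\<close> be a basis of the whole space of which the vectors
  \<open>b\<^sub>i\<close>, \<open>i \<in> K\<close>, form a basis of \<open>ker M\<close>. Those are eigenvectors
  of \<open>A\<close> for \<open>-1/c\<close>, so \<open>I + x A\<close> multiplies each of them by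
  \<open>1 - x/c\<close>. Pulling these factors out of the determinant with rows
  \<open>(I + x A) b\<^sub>i\<close> gives
  \<open>det P * det (I + x A) = (1 - x/c) ^ card K * det Q(x)\<close>, where \<open>P\<close> has the rows
  \<open>b\<^sub>i\<close>. At \<open>x = c\<close> the rows of
  \<open>Q\<close> are the \<open>b\<^sub>i\<close> with \<open>i \<in> K\<close>, which span \<open>ker M\<close>, and the
  remaining \<open>M b\<^sub>i\<close>, which span the image of \<open>M\<close>. By symmetry of
  \<open>M\<close> these two spaces are orthogonal complements, so \<open>det Q(c) \<noteq> 0\<close> and
  \<open>card K\<close> is the exact order. If \<open>c = 0\<close> then \<open>K\<close> is empty, and the argument
  stays valid with \<open>1 / 0 = 0\<close>.
\<close>
lemma order_det_pencil:
  fixes A :: "real ^ 'n ^ 'n"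
  assumes sym: "transpose A = A"
    and p: "\<And>x. poly p x = det (mat 1 + x *\<^sub>R A)"
  shows "order c p + rank (mat 1 + c *\<^sub>R A) = CARD('n)"
proof -
  define M where "M = mat 1 + c *\<^sub>R A"
  define N where "N = {v. M *v v = 0}"
  have Mv: "(mat 1 + x *\<^sub>R A) *v v = v + x *\<^sub>R (A *v v)" for x v
    by (simp add: matrix_vector_mult_add_rdistrib scaleR_matrix_vector_assoc)
  have symx: "transpose (mat 1 + x *\<^sub>R A) = mat 1 + x *\<^sub>R A" for x
    using sym by (auto simp: vec_eq_iff transpose_def mat_def)
  have adj: "(M *v v) \<bullet> w = v \<bullet> (M *v w)" for v w
    using dot_lmul_matrix[of v M w] symx[of c] by (metis M_def transpose_matrix_vector)
  have N_eq: "N = {y \<in> UNIV. \<forall>x \<in> range ((*v) M). orthogonal x y}"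
  proof -
    have "M *v y = 0 \<longleftrightarrow> (\<forall>x. (M *v x) \<bullet> y = 0)" for y
      by (metis adj inner_eq_zero_iff inner_zero_right)
    then show ?thesis by (auto simp: N_def orthogonal_def)
  qed
  have subN: "subspace N"
    by (auto simp: N_def subspace_def matrix_vector_right_distrib matrix_vector_mult_scaleR)
  have dimN: "dim N + rank M = CARD('n)"
    using dim_subspace_orthogonal_to_vectors[of "range ((*v) M)" UNIV]
    by (simp add: N_eq rank_dim_range linear_subspace_image subspace_UNIV)
  obtain B where B: "B \<subseteq> N" "independent B" "span B = N" "card B = dim N"
    using basis_subspace_exists[OF subN] by metis
  define C where "C = extend_basis B"
  have C: "B \<subseteq> C" "independent C" "span C = UNIV"
    using extend_basis_superset[OF B(2)] independent_extend_basis[OF B(2)]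
      span_extend_basis[OF B(2)] by (auto simp: C_def)
  have "finite C" "card C = CARD('n)"
    using C independent_imp_finite dim_eq_card[of C UNIV] by auto
  then obtain b where b: "bij_betw b (UNIV :: 'n set) C"
    using finite_same_card_bij by (metis finite_class.finite_UNIV)
  define K where "K = {i. b i \<in> B}"
  have bK: "b ` K = B" and cardK: "card K = dim N"
  proof -
    show "b ` K = B" using b C(1) by (auto simp: K_def bij_betw_def)
    moreover have "inj_on b K" using b by (auto simp: bij_betw_def intro: inj_on_subset)
    ultimately show "card K = dim N" using B(4) card_image by metis
  qed
  have ev: "A *v b i = (- 1 / c) *\<^sub>R b i" and c0: "c \<noteq> 0" if "i \<in> K" for i
  proof -
    have "b i \<in> N" using that B(1) by (auto simp: K_def)
    then have eq: "b i + c *\<^sub>R (A *v b i) = 0" by (simp add: N_def M_def Mv)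
    have "b i \<noteq> 0" using that B(2) dependent_zero[of B] by (auto simp: K_def)
    with eq show "c \<noteq> 0" by auto
    then have "A *v b i = (1 / c) *\<^sub>R (c *\<^sub>R (A *v b i))" by simp
    also have "c *\<^sub>R (A *v b i) = - b i" using eq by (simp add: eq_neg_iff_add_eq_0 add.commute)
    finally show "A *v b i = (- 1 / c) *\<^sub>R b i" by simp
  qed
  define P where "P = (\<chi> i. b i)"
  define Q :: "real poly ^ 'n ^ 'n" where
    "Q = (\<chi> i j. if i \<in> K then [:b i $ j:] else [:b i $ j, (A *v b i) $ j:])"
  \<comment> \<open>The evaluation of \<open>Q\<close> at \<open>x\<close>. The polynomial matrix itself is there only
    to make the cofactor of \<open>(1 - x / c) ^ dim N\<close> a polynomial in \<open>x\<close>.\<close>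
  define Qx where "Qx x = (\<chi> i. if i \<in> K then b i else (mat 1 + x *\<^sub>R A) *v b i)" for x
  have polyQ: "poly (det Q) x = det (Qx x)" for x
    unfolding poly_det by (rule arg_cong[of _ _ det]) (simp add: vec_eq_iff Q_def Qx_def Mv)
  have factor: "det P * poly p x = (1 - x / c) ^ dim N * poly (det Q) x" for x
  proof -
    let ?d = "\<lambda>i. if i \<in> K then 1 - x / c else 1"
    have "P ** (mat 1 + x *\<^sub>R A) = (\<chi> i. (mat 1 + x *\<^sub>R A) *v b i)"
    proof -
      have "(mat 1 + x *\<^sub>R A) $ k $ j = (mat 1 + x *\<^sub>R A) $ j $ k" for j k
        by (subst symx[symmetric]) (simp only: transpose_def vec_lambda_beta)
      then have "(P ** (mat 1 + x *\<^sub>R A)) $ i $ j = ((mat 1 + x *\<^sub>R A) *v b i) $ j" for i j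
        by (simp only: matrix_matrix_mult_def matrix_vector_mult_def P_def vec_lambda_beta mult.commute)
      then show ?thesis by (simp add: vec_eq_iff)
    qed
    also have "\<dots> = (\<chi> i. ?d i *s Qx x $ i)"
    proof -
      have "(mat 1 + x *\<^sub>R A) *v b i = ?d i *s Qx x $ i" for i
        by (cases "i \<in> K") (simp_all add: Qx_def Mv ev vec_eq_iff left_diff_distrib)
      then show ?thesis by simp
    qed
    finally have PN: "P ** (mat 1 + x *\<^sub>R A) = (\<chi> i. ?d i *s Qx x $ i)" .
    have "det P * det (mat 1 + x *\<^sub>R A) = det (\<chi> i. ?d i *s Qx x $ i)"
      by (simp only: PN flip: det_mul)
    also have "\<dots> = prod ?d UNIV * det (\<chi> i. Qx x $ i)"
      by (rule det_rows_mul)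
    finally have "det P * det (mat 1 + x *\<^sub>R A) = prod ?d UNIV * det (Qx x)"
      by (simp only: vec_lambda_eta)
    moreover have "prod ?d UNIV = (1 - x / c) ^ dim N"
      by (simp add: prod.If_cases cardK)
    ultimately show ?thesis by (simp add: p polyQ)
  qed
  have nz: "poly (det Q) c \<noteq> 0"
  proof -
    \<comment> \<open>A vector \<open>v\<close> orthogonal to all \<open>M b\<^sub>i\<close> satisfies \<open>M v = 0\<close> by symmetry;
      being also orthogonal to \<open>ker M\<close>, it vanishes.\<close>
    have "v = 0" if v: "Qx c *v v = 0" for v
    proof -
      have dot: "(Qx c $ i) \<bullet> v = 0" for i
        using v by (metis matrix_vector_mul_component zero_index)
      have "(M *v v) \<bullet> b i = 0" for i
      proof (cases "i \<in> K")
        case True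
        then have "M *v b i = 0" using B(1) by (auto simp: K_def N_def)
        then show ?thesis by (simp add: adj)
      next
        case False
        then have "(M *v b i) \<bullet> v = 0" using dot[of i] by (simp add: Qx_def M_def)
        then show ?thesis by (metis adj inner_commute)
      qed
      then have "orthogonal (M *v v) y" if "y \<in> C" for y
        using b that by (auto simp: bij_betw_def orthogonal_def)
      then have "orthogonal (M *v v) (M *v v)"
        using orthogonal_to_span[of "M *v v" C "M *v v"] C(3) by auto
      then have "v \<in> span B" by (simp add: orthogonal_def B(3) N_def)
      moreover have "orthogonal v y" if "y \<in> B" for y
      proof -
        obtain i where "i \<in> K" "y = b i" using \<open>y \<in> B\<close> unfolding bK[symmetric] by blast
        then show ?thesis using dot[of i] by (simp add: Qx_def orthogonal_def inner_commute)
      qed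
      ultimately have "orthogonal v v" using orthogonal_to_span by blast
      then show ?thesis by (simp add: orthogonal_def)
    qed
    then have "invertible (Qx c)"
      by (metis invertible_left_inverse matrix_left_invertible_ker)
    then show ?thesis by (simp add: polyQ invertible_det_nz)
  qed
  have detP: "det P \<noteq> 0"
  proof -
    have "v = 0" if v: "P *v v = 0" for v
    proof -
      have "b i \<bullet> v = 0" for i
        using v by (metis P_def matrix_vector_mul_component vec_lambda_beta zero_index)
      then have "orthogonal v y" if "y \<in> C" for y
        using b that by (auto simp: bij_betw_def orthogonal_def inner_commute)
      then have "orthogonal v v" using orthogonal_to_span[of v C v] C(3) by auto
      then show ?thesis by (simp add: orthogonal_def)
    qed
    then show ?thesis
      by (metis invertible_det_nz invertible_left_inverse matrix_left_invertible_ker)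
  qed
  define k where "k = (- 1 / c) ^ dim N"
  have k: "k \<noteq> 0"
    using c0 cardK by (cases "K = {}") (auto simp: k_def)
  have lin: "(1 - x / c) ^ dim N = k * (x - c) ^ dim N" for x
  proof (cases "K = {}")
    case True
    then have "dim N = 0" using cardK by (metis card.empty)
    then show ?thesis by (simp only: k_def power_0 mult_1)
  next
    case False
    then have "c \<noteq> 0" using c0 by auto
    then have eq: "1 - x / c = (- 1 / c) * (x - c)" by (simp add: field_simps)
    show ?thesis unfolding eq k_def by (rule power_mult_distrib)
  qed
  have "smult (det P) p = smult k ([:- c, 1:] ^ dim N * det Q)"
    by (rule iffD1[OF poly_eq_poly_eq_iff], rule ext) (simp add: factor lin poly_power)
  then have "order c p = order c ([:- c, 1:] ^ dim N * det Q)"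
    using detP k by (metis order_smult)
  also have "\<dots> = dim N"
    using nz by (subst order_mult) (auto simp: order_power_n_n order_0I)
  finally show ?thesis using dimN by (simp add: M_def)
qed

section \<open>Reduced representations and their Gram matrices\<close>

text \<open>
  The matrix of \<open>L\<close> after \<open>a \<mapsto> \<Sum> a\<^sub>i u\<^sub>i\<close> is the Gram matrix, so the image
  of \<open>L\<close> is at least as large as the column space, whose dimension is \<open>dim U\<close>; a
  linear map cannot raise the dimension, hence equality and injectivity. That the form is
  nondegenerate and that the \<open>u\<^sub>i\<close> span \<open>U\<close> are consequences. As \<open>\<alpha>\<close> is only
  constrained on \<open>U\<close>, the map is extended linearly from a basis of \<open>U\<close> to the
  ambient space.
\<close>
lemma gram_coordinates:
  fixes U :: "'a::real_vector set" and u :: "'n::finite \<Rightarrow> 'a"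
  assumes Q: "quadratic_space U \<alpha>" and u: "\<And>i. u i \<in> U"
    and dim: "dim U = rank (rep_matrix \<alpha> u)"
  obtains L :: "'a \<Rightarrow> real ^ 'n" where "linear L" "\<And>x i. x \<in> U \<Longrightarrow> L x $ i = \<alpha> x (u i)"
    "inj_on L U" "L ` U = range ((*v) (rep_matrix \<alpha> u))"
proof -
  let ?G = "rep_matrix \<alpha> u"
  have sub: "subspace U" and sym: "\<And>x y. x \<in> U \<Longrightarrow> y \<in> U \<Longrightarrow> \<alpha> x y = \<alpha> y x"
    and add: "\<And>x y z. x \<in> U \<Longrightarrow> y \<in> U \<Longrightarrow> z \<in> U \<Longrightarrow> \<alpha> (x + y) z = \<alpha> x z + \<alpha> y z"
    and scale: "\<And>r x y. x \<in> U \<Longrightarrow> y \<in> U \<Longrightarrow> \<alpha> (r *\<^sub>R x) y = r * \<alpha> x y"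
    using Q unfolding quadratic_space_def by blast+
  obtain F where F: "finite F" "U = span F" using Q unfolding quadratic_space_def by blast
  obtain B where B: "B \<subseteq> U" "independent B" "U \<subseteq> span B" "card B = dim U"
    using real_vector.basis_exists by metis
  have finB: "finite B" using real_vector.independent_span_bound F B by metis
  have spanB: "span B = U" using B(1,3) sub by (metis span_subspace)
  obtain L :: "'a \<Rightarrow> real ^ 'n" where L: "linear L" "\<forall>x\<in>B. L x = (\<chi> i. \<alpha> x (u i))"
    using linear_independent_extend[OF B(2), where f = "\<lambda>x. \<chi> i. \<alpha> x (u i)"] by blast
  have "span B \<subseteq> {x \<in> U. L x = (\<chi> i. \<alpha> x (u i))}"
  proof (rule span_minimal)
    show "B \<subseteq> {x \<in> U. L x = (\<chi> i. \<alpha> x (u i))}" using B(1) L(2) by auto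
    have "\<alpha> 0 (u i) = 0" for i using scale[of 0 "u i" 0] u sub subspace_0 by fastforce
    then show "subspace {x \<in> U. L x = (\<chi> i. \<alpha> x (u i))}"
      using sub L(1) by (auto simp: subspace_def linear_0 linear_add linear_scale add scale u
          vec_eq_iff)
  qed
  then have Lx: "L x $ i = \<alpha> x (u i)" if "x \<in> U" for x i using that spanB by auto
  have "?G *v a \<in> L ` U" for a
  proof -
    let ?x = "\<Sum>i\<in>UNIV. a $ i *\<^sub>R u i"
    have "L ?x $ j = (?G *v a) $ j" for j
    proof -
      have "L ?x $ j = (\<Sum>i\<in>UNIV. a $ i * \<alpha> (u i) (u j))"
        using L(1) u by (simp add: linear_sum linear_scale Lx)
      also have "\<dots> = (?G *v a) $ j"
        using sym u by (auto simp: matrix_vector_mult_def rep_matrix_def mult.commute intro!: sum.cong)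
      finally show ?thesis .
    qed
    then have eq: "?G *v a = L ?x" by (simp only: vec_eq_iff simp_thms)
    have mem: "?x \<in> U" using sub u by (simp add: subspace_sum subspace_scale)
    show ?thesis by (rule image_eqI[where f = L and x = ?x, OF eq mem])
  qed
  then have le: "range ((*v) ?G) \<subseteq> L ` U" by auto
  have span_LB: "L ` U = span (L ` B)" using L(1) spanB linear_span_image by metis
  have rk: "card B = dim (range ((*v) ?G))" using B(4) dim by (simp add: rank_dim_range)
  have d1: "dim (range ((*v) ?G)) \<le> dim (L ` U)" using le by (rule dim_subset)
  have d2: "dim (L ` U) \<le> card (L ` B)" using span_LB finB by (intro dim_le_card) auto
  have d3: "card (L ` B) \<le> card B" using finB by (rule card_image_le)
  have "L ` U = range ((*v) ?G)"
    using le d1 d2 d3 rk sub L(1)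
    by (intro subspace_dim_equal[symmetric]) (auto intro!: linear_subspace_image subspace_UNIV)
  moreover have "inj_on L U"
  proof -
    have "independent (L ` B)"
      using span_LB finB d1 d3 rk by (intro card_le_dim_spanning[of _ "L ` U"]) (auto intro: span_base)
    moreover have "inj_on L B" using d1 d2 d3 rk finB by (intro eq_card_imp_inj_on) auto
    ultimately show ?thesis using L(1) spanB linear_inj_on_span_iff_independent_image by metis
  qed
  ultimately show thesis using that L(1) Lx by blast
qed

text \<open>
  The coordinates carry the whole form: \<open>x\<close> and \<open>\<Sum> a\<^sub>i u\<^sub>i\<close> have the same
  coordinates, hence coincide, and pairing this sum with \<open>y\<close> gives
  \<open>\<Sum> a\<^sub>i \<alpha>(u\<^sub>i, y)\<close>.
\<close>
lemma form_via_gram_coordinates: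
  fixes U :: "'a::real_vector set" and u :: "'n::finite \<Rightarrow> 'a" and L :: "'a \<Rightarrow> real ^ 'n"
  assumes Q: "quadratic_space U \<alpha>" and u: "\<And>i. u i \<in> U" and L: "inj_on L U"
    "\<And>x i. x \<in> U \<Longrightarrow> L x $ i = \<alpha> x (u i)"
    and x: "x \<in> U" "L x = rep_matrix \<alpha> u *v a" and y: "y \<in> U"
  shows "\<alpha> x y = a \<bullet> L y"
proof -
  have sub: "subspace U" and sym: "\<And>x y. x \<in> U \<Longrightarrow> y \<in> U \<Longrightarrow> \<alpha> x y = \<alpha> y x"
    and add: "\<And>x y z. x \<in> U \<Longrightarrow> y \<in> U \<Longrightarrow> z \<in> U \<Longrightarrow> \<alpha> (x + y) z = \<alpha> x z + \<alpha> y z"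
    and scale: "\<And>r x y. x \<in> U \<Longrightarrow> y \<in> U \<Longrightarrow> \<alpha> (r *\<^sub>R x) y = r * \<alpha> x y"
    using Q unfolding quadratic_space_def by blast+
  have zero: "\<alpha> 0 z = 0" if "z \<in> U" for z using scale[of 0 z 0] sub subspace_0 that by fastforce
  have *: "(\<Sum>i\<in>I. a $ i *\<^sub>R u i) \<in> U \<and>
      \<alpha> (\<Sum>i\<in>I. a $ i *\<^sub>R u i) z = (\<Sum>i\<in>I. a $ i * \<alpha> (u i) z)"
    if z: "z \<in> U" and "finite I" for z I
    using \<open>finite I\<close> by induction (auto simp: zero z subspace_0 sub subspace_add subspace_scale add scale u)
  let ?x = "\<Sum>i\<in>UNIV. a $ i *\<^sub>R u i"
  have mem: "?x \<in> U" using *[OF y, of UNIV] by simp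
  have "L ?x = L x"
    using *[OF u] sym u mem
    by (auto simp: vec_eq_iff L(2) x(2) matrix_vector_mult_def rep_matrix_def mult.commute
        intro!: sum.cong)
  then have "x = ?x" using L(1) x(1) mem by (auto dest: inj_onD)
  then show ?thesis using *[OF y, of UNIV] sym u y by (simp add: inner_vec_def L(2))
qed

text \<open>
  Both coordinate maps have the same image, the column space of the common Gram matrix, and the
  isometry is the first one followed by the inverse of the second.
\<close>
lemma isomorphic_if_rep_matrix_eq:
  fixes u :: "'n::finite \<Rightarrow> 'a::real_vector" and v :: "'n \<Rightarrow> 'b::real_vector"
  assumes U: "quadratic_space U \<alpha>" "\<And>i. u i \<in> U" "dim U = rank (rep_matrix \<alpha> u)"
    and V: "quadratic_space V \<beta>" "\<And>i. v i \<in> V" "dim V = rank (rep_matrix \<beta> v)"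
    and G: "rep_matrix \<alpha> u = rep_matrix \<beta> v"
  shows "isomorphic_reps U \<alpha> u V \<beta> v"
proof -
  obtain L :: "'a \<Rightarrow> real ^ 'n" where L: "linear L" "\<And>x i. x \<in> U \<Longrightarrow> L x $ i = \<alpha> x (u i)"
    "inj_on L U" "L ` U = range ((*v) (rep_matrix \<alpha> u))"
    using gram_coordinates[OF U] by metis
  obtain R :: "'b \<Rightarrow> real ^ 'n" where R: "linear R" "\<And>x i. x \<in> V \<Longrightarrow> R x $ i = \<beta> x (v i)"
    "inj_on R V" "R ` V = range ((*v) (rep_matrix \<beta> v))"
    using gram_coordinates[OF V] by metis
  have sub: "subspace U" "subspace V" using U(1) V(1) by (auto simp: quadratic_space_def)
  define f where "f = inv_into V R \<circ> L"
  have bij: "bij_betw f U V"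
    unfolding f_def
  proof (rule bij_betw_trans)
    show "bij_betw L U (R ` V)" using L(3,4) R(4) G by (simp add: bij_betw_def)
    show "bij_betw (inv_into V R) (R ` V) V"
      using inj_on_imp_bij_betw[OF R(3)] by (rule bij_betw_inv_into)
  qed
  then have fV: "f x \<in> V" if "x \<in> U" for x using that by (auto simp: bij_betw_def)
  have Rf: "R (f x) = L x" if "x \<in> U" for x
    unfolding f_def comp_def using that L(4) R(4) G by (intro f_inv_into_f) auto
  have f_eq: "f x = y" if "x \<in> U" "y \<in> V" "L x = R y" for x y
    using that R(3) Rf fV by (metis inj_onD)
  have "f (x + y) = f x + f y" if "x \<in> U" "y \<in> U" for x y
    using that sub by (intro f_eq) (auto simp: subspace_add fV Rf linear_add[OF L(1)] linear_add[OF R(1)])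
  moreover have "f (r *\<^sub>R x) = r *\<^sub>R f x" if "x \<in> U" for r x
    using that sub by (intro f_eq) (auto simp: subspace_scale fV Rf linear_scale[OF L(1)] linear_scale[OF R(1)])
  moreover have "\<beta> (f x) (f y) = \<alpha> x y" if xy: "x \<in> U" "y \<in> U" for x y
  proof -
    obtain a where a: "L x = rep_matrix \<alpha> u *v a" using L(4) xy(1) by blast
    have "\<alpha> x y = a \<bullet> L y"
      using form_via_gram_coordinates[OF U(1,2) L(3,2)] a xy by blast
    moreover have "\<beta> (f x) (f y) = a \<bullet> R (f y)"
      using form_via_gram_coordinates[OF V(1,2) R(3,2)] a xy fV Rf G by metis
    ultimately show ?thesis using Rf xy by simp
  qed
  moreover have "f (u i) = v i" for i
  proof (rule f_eq)
    show "L (u i) = R (v i)" using G U(2) V(2) by (simp add: vec_eq_iff L(2) R(2) rep_matrix_def)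
  qed (use U V in auto)
  ultimately show ?thesis
    using bij unfolding isomorphic_reps_def isometry_between_def by (intro exI[of _ f]) auto
qed

section \<open>Parameters of graph representations\<close>

lemma eps_commute: "eps \<Gamma> i j = eps \<Gamma> j i"
  by (simp add: eps_def insert_commute)

lemma rep_matrix_eq_S_mat: "is_rep_with \<Gamma> E \<alpha> u p \<Longrightarrow> rep_matrix \<alpha> u = S_mat \<Gamma> (fst p) (snd p)"
  by (auto simp: is_rep_with_def rep_matrix_def S_mat_def vec_eq_iff)

lemma unique_params:
  fixes u :: "'n::finite \<Rightarrow> 'a::real_vector"
  assumes "is_rep \<Gamma> E \<alpha> u" and card: "CARD('n) \<ge> 2"
  shows "\<exists>!p. is_rep_with \<Gamma> E \<alpha> u p"
proof -
  obtain i j :: 'n where ij: "i \<noteq> j"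
    using card by (metis card_2_iff' card_le_Suc0_iff_eq finite_class.finite_UNIV not_less_eq_eq
        numeral_2_eq_2)
  have "p = q" if "is_rep_with \<Gamma> E \<alpha> u p" "is_rep_with \<Gamma> E \<alpha> u q" for p q
  proof (rule prod_eqI)
    show "fst p = fst q" using that by (auto simp: is_rep_with_def)
    have "eps \<Gamma> i j * snd p = eps \<Gamma> i j * snd q" using that ij unfolding is_rep_with_def by metis
    then show "snd p = snd q" by (simp add: eps_def split: if_splits)
  qed
  then show ?thesis using assms(1) unfolding is_rep_def by blast
qed

lemma rep_exists:
  fixes \<Gamma> :: "'n::finite set set"
  shows "is_rep_with \<Gamma> UNIV (\<lambda>x y. x \<bullet> (S_mat \<Gamma> (fst p) (snd p) *v y)) (\<lambda>i. axis i 1) p"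
proof -
  let ?S = "S_mat \<Gamma> (fst p) (snd p)"
  have "transpose ?S = ?S"
    by (auto simp: S_mat_def transpose_def vec_eq_iff eps_commute)
  then have symm: "x \<bullet> (?S *v y) = y \<bullet> (?S *v x)" for x y
    by (metis dot_lmul_matrix inner_commute transpose_matrix_vector)
  have fin: "\<exists>B. finite B \<and> (UNIV :: (real ^ 'n) set) = span B"
    using finite_Basis span_Basis by metis
  have "quadratic_space UNIV (\<lambda>x y. x \<bullet> (?S *v y))"
    unfolding quadratic_space_def
    by (intro conjI ballI allI subspace_UNIV fin symm) (simp_all add: inner_left_distrib)
  moreover have "axis i 1 \<bullet> (?S *v axis j 1) = ?S $ i $ j" for i j
    by (simp add: inner_axis' matrix_vector_mult_basis column_def)
  ultimately show ?thesis
    by (simp add: is_rep_with_def S_mat_def)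
qed

lemma reduced_repD:
  assumes "reduced_rep \<Gamma> U \<alpha> u"
  shows "quadratic_space U \<alpha>" "u i \<in> U" "dim U = rank (rep_matrix \<alpha> u)"
  using assms by (auto simp: reduced_rep_def is_rep_def is_rep_with_def)

lemma isomorphic_iff_params_eq:
  fixes u :: "'n::finite \<Rightarrow> 'a::real_vector" and v :: "'n \<Rightarrow> 'b::real_vector"
  assumes u: "reduced_rep \<Gamma> U \<alpha> u" and v: "reduced_rep \<Gamma> V \<beta> v"
  shows "isomorphic_reps U \<alpha> u V \<beta> v \<longleftrightarrow> params \<Gamma> U \<alpha> u = params \<Gamma> V \<beta> v"
proof
  have U: "quadratic_space U \<alpha>" "\<And>i. u i \<in> U" "dim U = rank (rep_matrix \<alpha> u)"
    and V: "quadratic_space V \<beta>" "\<And>i. v i \<in> V" "dim V = rank (rep_matrix \<beta> v)"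
    using reduced_repD[OF u] reduced_repD[OF v] by simp_all
  show "params \<Gamma> U \<alpha> u = params \<Gamma> V \<beta> v" if "isomorphic_reps U \<alpha> u V \<beta> v"
  proof -
    have "\<beta> (v i) (v j) = \<alpha> (u i) (u j)" for i j
      using that U(2) unfolding isomorphic_reps_def isometry_between_def by (metis comp_apply)
    then show ?thesis using U V by (simp add: params_def is_rep_with_def)
  qed
  show "isomorphic_reps U \<alpha> u V \<beta> v" if eq: "params \<Gamma> U \<alpha> u = params \<Gamma> V \<beta> v"
  proof -
    obtain p where "is_rep_with \<Gamma> U \<alpha> u p" using u by (auto simp: reduced_rep_def is_rep_def)
    moreover from this have "is_rep_with \<Gamma> V \<beta> v p" using eq by (auto simp: params_def)
    ultimately have "rep_matrix \<alpha> u = rep_matrix \<beta> v" by (simp add: rep_matrix_eq_S_mat)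
    then show ?thesis by (rule isomorphic_if_rep_matrix_eq[OF U V])
  qed
qed

lemma order_chi_poly:
  fixes \<Gamma> :: "'n::finite set set"
  shows "order c (chi_poly \<Gamma>) + rank (S_mat \<Gamma> 1 c) = CARD('n)"
proof -
  have S: "S_mat \<Gamma> 1 x = mat 1 + x *\<^sub>R S_mat \<Gamma> 0 1" for x :: real
    by (auto simp: S_mat_def mat_def vec_eq_iff)
  have "poly (chi_poly \<Gamma>) x = det (mat 1 + x *\<^sub>R S_mat \<Gamma> 0 1)" for x
    unfolding chi_poly_def poly_det S[symmetric]
    by (rule arg_cong[of _ _ det]) (auto simp: S_mat_def vec_eq_iff eps_def)
  moreover have "transpose (S_mat \<Gamma> 0 1) = S_mat \<Gamma> 0 (1 :: real)"
    by (auto simp: S_mat_def transpose_def vec_eq_iff eps_commute)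
  ultimately show ?thesis using order_det_pencil S by metis
qed

theorem mainTheorem1:
  fixes \<Gamma> :: "'n::finite set set"
  assumes "graph \<Gamma>"
  shows
    "(\<forall>(E :: 'a::real_vector set) \<alpha> u.
        is_rep \<Gamma> E \<alpha> u \<longrightarrow> CARD('n) \<ge> 2 \<longrightarrow> (\<exists>!p. is_rep_with \<Gamma> E \<alpha> u p)) \<and>
     (\<forall>p :: real \<times> real. \<exists>(E :: (real ^ 'n) set) \<alpha> u. is_rep_with \<Gamma> E \<alpha> u p) \<and>
     (\<forall>(U :: 'a set) \<alpha> u (V :: 'b::real_vector set) \<beta> v.
        reduced_rep \<Gamma> U \<alpha> u \<longrightarrow> reduced_rep \<Gamma> V \<beta> v \<longrightarrow>
        (isomorphic_reps U \<alpha> u V \<beta> v \<longleftrightarrow> params \<Gamma> U \<alpha> u = params \<Gamma> V \<beta> v)) \<and>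
     (\<forall>(U :: 'a set) \<alpha> u c.
        reduced_rep \<Gamma> U \<alpha> u \<longrightarrow> rep_matrix \<alpha> u = S_mat \<Gamma> 1 c \<longrightarrow>
        dim U = rank (S_mat \<Gamma> 1 c) \<and>
        int (rank (S_mat \<Gamma> 1 c)) = int CARD('n) - int (order c (chi_poly \<Gamma>)))"
proof (intro conjI allI impI)
  show "\<exists>!p. is_rep_with \<Gamma> E \<alpha> u p" if "is_rep \<Gamma> E \<alpha> u" "CARD('n) \<ge> 2"
    for E :: "'a set" and \<alpha> u
    using that by (rule unique_params)
  show "\<exists>(E :: (real ^ 'n) set) \<alpha> u. is_rep_with \<Gamma> E \<alpha> u p" for p
    using rep_exists by blast
  show "isomorphic_reps U \<alpha> u V \<beta> v \<longleftrightarrow> params \<Gamma> U \<alpha> u = params \<Gamma> V \<beta> v"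
    if "reduced_rep \<Gamma> U \<alpha> u" "reduced_rep \<Gamma> V \<beta> v"
    for U :: "'a set" and \<alpha> u and V :: "'b set" and \<beta> v
    using that by (rule isomorphic_iff_params_eq)
  show "dim U = rank (S_mat \<Gamma> 1 c)"
    if "reduced_rep \<Gamma> U \<alpha> u" "rep_matrix \<alpha> u = S_mat \<Gamma> 1 c" for U :: "'a set" and \<alpha> u c
    using that by (simp add: reduced_rep_def)
  show "int (rank (S_mat \<Gamma> 1 c)) = int CARD('n) - int (order c (chi_poly \<Gamma>))" for c
    using order_chi_poly[of c \<Gamma>] by linarith
qed

end
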